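(* Let $L>0$ and suppose that $F:\mathbb{R}^d\rightarrow\mathbb{R}$ is (possibly non-convex) $L$-smooth and $\gamma=1/L$. Let $T\in\{1,\ldots,d\}$. Then for any $x,x^+\in\mathbb{R}^d$ with $x^+=x-\gamma Q_T(\nabla F(x))$ we have $$F(x^+)\leq F(x)-\frac{\alpha(T)}{2L}\|\nabla F(x)\|^2,\qquad\text{where}\qquad \alpha(T)=\frac{\|Q_T(\nabla F(x))\|^2}{\|\nabla F(x)\|^2}.$$ Moreover, there are $L$-smooth functions $F$ for which the inequality is tight (holds with equality) for every $T=1,\ldots,d$.
   Context: $\|\cdot\|$ is the Euclidean norm. A continuously differentiable $F:\mathbb{R}^d\to\mathbb{R}$ is $L$-smooth if $\|\nabla F(x)-\nabla F(y)\|\le L\|x-y\|$ for all $x,y\in\mathbb{R}^d$. For $g\in\mathbb{R}^d$ and $T\in\{0,1,\ldots,d\}$, $I_T(g)$ is the index set of the $T$ components of $g$ with largest magnitude (ties broken by any fixed rule), and the sparsifier $Q_T$ is defined by $[Q_T(g)]_j=g_j$ if $j\in I_T(g)$ and $[Q_T(g)]_j=0$ otherwise. The ratio $\alpha(T)$ (which depends on $x$) is understood at points with $\nabla F(x)\neq 0$. *)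

theory Defs
  imports "HOL-Analysis.Analysis"
begin

definition gradient :: "('a::euclidean_space \<Rightarrow> real) \<Rightarrow> 'a \<Rightarrow> 'a" (\<open>\<nabla>\<close>) where
  "\<nabla> F x = (THE g. GDERIV F x :> g)"

definition continuously_differentiable :: "('a::euclidean_space \<Rightarrow> real) \<Rightarrow> bool" where
  "continuously_differentiable F \<longleftrightarrow>
     F differentiable_on UNIV \<and> continuous_on UNIV (\<nabla> F)"

definition L_smooth :: "real \<Rightarrow> ('a::euclidean_space \<Rightarrow> real) \<Rightarrow> bool" where
  "L_smooth L F \<longleftrightarrow> continuously_differentiable F \<and>
     (\<forall>x y. norm (\<nabla> F x - \<nabla> F y) \<le> L * norm (x - y))"

(* A rule I assigns to every T and g a set of T indices carrying the components of g of
   largest magnitude. When magnitudes tie there are several such sets, and a rule is any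
   fixed choice among them. No compatibility between different values of T is required. *)
definition top_index_rule :: "(nat \<Rightarrow> real ^ 'n \<Rightarrow> 'n set) \<Rightarrow> bool" where
  "top_index_rule I \<longleftrightarrow>
     (\<forall>T \<le> CARD('n). \<forall>g. card (I T g) = T \<and>
        (\<forall>i \<in> I T g. \<forall>j. j \<notin> I T g \<longrightarrow> \<bar>g $ j\<bar> \<le> \<bar>g $ i\<bar>))"

definition sparsify :: "(nat \<Rightarrow> real ^ 'n \<Rightarrow> 'n set) \<Rightarrow> nat \<Rightarrow> real ^ 'n \<Rightarrow> real ^ 'n" where
  "sparsify I T g = (\<chi> j. if j \<in> I T g then g $ j else 0)"

(* Meaningful only where the gradient is nonzero. *)
definition sparsification_ratio ::
  "(nat \<Rightarrow> real ^ 'n \<Rightarrow> 'n set) \<Rightarrow> (real ^ 'n \<Rightarrow> real) \<Rightarrow> real ^ 'n \<Rightarrow> nat \<Rightarrow> real" where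
  "sparsification_ratio I F x T =
     (norm (sparsify I T (\<nabla> F x)))\<^sup>2 / (norm (\<nabla> F x))\<^sup>2"

end

theory Submission
  imports Defs
begin

text \<open>
  The inequality is one step of the quadratic upper bound
  \<open>F (x + v) \<le> F x + \<nabla> F x \<bullet> v + L / 2 * (norm v)\<^sup>2\<close>
  that every \<open>L\<close>-smooth function satisfies (\<open>L_smooth_quadratic_upper_bound\<close>). Sparsification is
  a coordinate projection of \<open>g\<close>, and the discarded part of \<open>g\<close> is orthogonal to the kept one, so
  \<open>g \<bullet> q = q \<bullet> q\<close> for \<open>q = sparsify I T g\<close> (\<open>inner_sparsify\<close>). With \<open>g = \<nabla> F x\<close> and
  \<open>v = - (1 / L) q\<close> the linear term contributes \<open>- (norm q)\<^sup>2 / L\<close> and the quadratic term gives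
  half of it back; the remaining decrease \<open>(norm q)\<^sup>2 / (2 * L)\<close> is the claimed one, because
  \<open>sparsification_ratio\<close> is \<open>(norm q)\<^sup>2\<close> divided by \<open>(norm g)\<^sup>2\<close>.

  Equality holds as soon as the quadratic upper bound is exact, which is the case for
  \<open>F x = L / 2 * (norm x)\<^sup>2\<close> at every point, for every \<open>T\<close> and every tie-breaking rule.
\<close>

lemma gradient_eqI:
  fixes F :: "'a::euclidean_space \<Rightarrow> real"
  assumes "GDERIV F x :> g"
  shows "\<nabla> F x = g"
  unfolding gradient_def
proof (rule the_equality)
  fix h assume "GDERIV F x :> h"
  then have "(\<lambda>v. v \<bullet> h) = (\<lambda>v. v \<bullet> g)"
    using assms unfolding gderiv_def by (rule has_derivative_unique)
  then show "h = g"
    by (metis inner_commute vector_eq_ldot)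
qed (rule assms)

text \<open>
  A differentiable function has a gradient because, in a Euclidean space, a linear functional
  is the inner product with the vector of its values on the basis.
\<close>

lemma differentiable_imp_GDERIV_gradient:
  fixes F :: "'a::euclidean_space \<Rightarrow> real"
  assumes "F differentiable at x"
  shows "GDERIV F x :> \<nabla> F x"
proof -
  obtain F' where F': "(F has_derivative F') (at x)"
    using assms unfolding differentiable_def by blast
  define g where "g = (\<Sum>b\<in>Basis. F' b *\<^sub>R b)"
  have lin: "linear F'"
    using F' by (rule has_derivative_linear)
  have "F' v = v \<bullet> g" for v
  proof -
    have "F' v = F' (\<Sum>b\<in>Basis. (v \<bullet> b) *\<^sub>R b)"
      by (simp add: euclidean_representation)
    also have "\<dots> = (\<Sum>b\<in>Basis. (v \<bullet> b) * F' b)"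
      by (simp add: linear_sum[OF lin] linear_cmul[OF lin])
    also have "\<dots> = v \<bullet> g"
      by (simp add: g_def inner_sum_right mult.commute)
    finally show ?thesis .
  qed
  then have "F' = (\<lambda>v. v \<bullet> g)" by blast
  with F' have "GDERIV F x :> g"
    unfolding gderiv_def by simp
  then show ?thesis
    using gradient_eqI by metis
qed

text \<open>
  Along the segment from \<open>x\<close> to \<open>x + v\<close>, the derivative of \<open>F\<close> minus its upper model is
  \<open>(\<nabla> F (x + t v) - \<nabla> F x) \<bullet> v - L * t * (norm v)\<^sup>2\<close>. By Cauchy--Schwarz and the Lipschitz bound
  this is nonpositive, so the difference, which starts at \<open>F x\<close>, can only decrease.
\<close>

lemma L_smooth_quadratic_upper_bound:
  fixes F :: "'a::euclidean_space \<Rightarrow> real"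
  assumes "L_smooth L F"
  shows "F (x + v) \<le> F x + \<nabla> F x \<bullet> v + L / 2 * (norm v)\<^sup>2"
proof -
  have grad: "(F has_derivative (\<lambda>h. h \<bullet> \<nabla> F y)) (at y)" for y
    using assms differentiable_imp_GDERIV_gradient[of F y]
    by (auto simp: L_smooth_def continuously_differentiable_def differentiable_on_def gderiv_def)
  define \<phi> where
    "\<phi> t = F (x + t *\<^sub>R v) - t * (\<nabla> F x \<bullet> v) - L / 2 * t\<^sup>2 * (norm v)\<^sup>2" for t
  define \<phi>' where
    "\<phi>' t = (\<nabla> F (x + t *\<^sub>R v) - \<nabla> F x) \<bullet> v - L * t * (norm v)\<^sup>2" for t
  have deriv: "(\<phi> has_real_derivative \<phi>' t) (at t)" for t
  proof -
    have "((\<lambda>t. x + t *\<^sub>R v) has_derivative (\<lambda>s. s *\<^sub>R v)) (at t)"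
      by (auto intro!: derivative_eq_intros)
    from has_derivative_compose[OF this grad]
    have "((\<lambda>t. F (x + t *\<^sub>R v)) has_real_derivative v \<bullet> \<nabla> F (x + t *\<^sub>R v)) (at t)"
      by (simp add: has_field_derivative_def mult_commute_abs)
    then show ?thesis
      unfolding \<phi>_def \<phi>'_def
      by (auto intro!: derivative_eq_intros simp: inner_diff_left inner_diff_right inner_commute)
  qed
  have nonpos: "\<phi>' t \<le> 0" if "0 \<le> t" for t
  proof -
    have "(\<nabla> F (x + t *\<^sub>R v) - \<nabla> F x) \<bullet> v \<le> norm (\<nabla> F (x + t *\<^sub>R v) - \<nabla> F x) * norm v"
      by (rule norm_cauchy_schwarz)
    also have "\<dots> \<le> (L * norm ((x + t *\<^sub>R v) - x)) * norm v"
      using assms unfolding L_smooth_def by (intro mult_right_mono norm_ge_zero) blast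
    also have "\<dots> = L * t * (norm v)\<^sup>2"
      using that by (simp add: power2_eq_square)
    finally show ?thesis
      by (simp add: \<phi>'_def)
  qed
  have "\<phi> 1 \<le> \<phi> 0"
    by (rule DERIV_nonpos_imp_nonincreasing) (use deriv nonpos in auto)
  then show ?thesis
    by (simp add: \<phi>_def)
qed

lemma inner_sparsify:
  "g \<bullet> sparsify I T g = (norm (sparsify I T g))\<^sup>2"
  unfolding power2_norm_eq_inner
  by (auto simp: inner_vec_def sparsify_def intro!: sum.cong)

lemma gradient_half_square_norm:
  fixes x :: "'a::euclidean_space"
  shows "\<nabla> (\<lambda>x. L / 2 * (norm x)\<^sup>2) x = L *\<^sub>R x"
    and "(\<lambda>x::'a. L / 2 * (norm x)\<^sup>2) differentiable at x"
proof -
  have "((\<lambda>x. L / 2 * (x \<bullet> x)) has_derivative (\<lambda>h. h \<bullet> (L *\<^sub>R x))) (at x)"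
    by (auto intro!: derivative_eq_intros simp: inner_commute)
  then have D: "((\<lambda>x. L / 2 * (norm x)\<^sup>2) has_derivative (\<lambda>h. h \<bullet> (L *\<^sub>R x))) (at x)"
    by (simp only: power2_norm_eq_inner)
  then show "\<nabla> (\<lambda>x. L / 2 * (norm x)\<^sup>2) x = L *\<^sub>R x"
    by (intro gradient_eqI) (simp only: gderiv_def)
  show "(\<lambda>x::'a. L / 2 * (norm x)\<^sup>2) differentiable at x"
    using D unfolding differentiable_def by blast
qed

lemma L_smooth_half_square_norm:
  assumes "0 \<le> L"
  shows "L_smooth L (\<lambda>x::'a::euclidean_space. L / 2 * (norm x)\<^sup>2)"
proof -
  have grad: "\<nabla> (\<lambda>x::'a. L / 2 * (norm x)\<^sup>2) = (\<lambda>x. L *\<^sub>R x)"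
    using gradient_half_square_norm(1) by blast
  have "norm (L *\<^sub>R x - L *\<^sub>R y) = L * norm (x - y)" for x y :: 'a
    using assms by (simp flip: scaleR_diff_right)
  then show ?thesis
    unfolding L_smooth_def continuously_differentiable_def grad
    by (auto intro!: continuous_intros differentiable_at_imp_differentiable_on
        gradient_half_square_norm(2))
qed

text \<open>
  By \<open>inner_sparsify\<close>, a step of size \<open>\<gamma>\<close> changes the quadratic model by
  \<open>- \<gamma> * s + L / 2 * \<gamma>\<^sup>2 * s\<close> with \<open>s = (norm (sparsify I T g))\<^sup>2\<close>. The step size \<open>1 / L\<close> is the
  minimiser of this parabola in \<open>\<gamma>\<close> for each \<open>s > 0\<close>.
\<close>

lemma quadratic_model_sparsified_step:
  fixes g :: "real ^ 'n" and I :: "nat \<Rightarrow> real ^ 'n \<Rightarrow> 'n set"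
    and T :: nat
  assumes "L > 0"
  defines "v \<equiv> - (1 / L) *\<^sub>R sparsify I T g"
  shows "g \<bullet> v + L / 2 * (norm v)\<^sup>2 = - (norm (sparsify I T g))\<^sup>2 / (2 * L)"
  using assms by (simp add: v_def inner_sparsify power_mult_distrib power_divide
      field_simps power2_eq_square)

lemma sparsification_ratio_times_square_norm:
  assumes "\<nabla> F x \<noteq> 0"
  shows "sparsification_ratio I F x T / (2 * L) * (norm (\<nabla> F x))\<^sup>2
    = (norm (sparsify I T (\<nabla> F x)))\<^sup>2 / (2 * L)"
  using assms by (simp add: sparsification_ratio_def)

theorem lemma1:
  fixes L \<gamma> :: real
  assumes "L > 0" and "\<gamma> = 1 / L"
  shows
    "(\<forall>(F :: real ^ 'n \<Rightarrow> real) I T x x'.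
        L_smooth L F \<longrightarrow> top_index_rule I \<longrightarrow> T \<in> {1..CARD('n)} \<longrightarrow> \<nabla> F x \<noteq> 0 \<longrightarrow>
        x' = x - \<gamma> *\<^sub>R sparsify I T (\<nabla> F x) \<longrightarrow>
        F x' \<le> F x - sparsification_ratio I F x T / (2 * L) * (norm (\<nabla> F x))\<^sup>2) \<and>
     (\<exists>F :: real ^ 'n \<Rightarrow> real.
        L_smooth L F \<and> (\<exists>x. \<nabla> F x \<noteq> 0) \<and>
        (\<forall>I T x x'.
          top_index_rule I \<longrightarrow> T \<in> {1..CARD('n)} \<longrightarrow> \<nabla> F x \<noteq> 0 \<longrightarrow>
          x' = x - \<gamma> *\<^sub>R sparsify I T (\<nabla> F x) \<longrightarrow>
          F x' = F x - sparsification_ratio I F x T / (2 * L) * (norm (\<nabla> F x))\<^sup>2))"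
proof (intro conjI)
  show "\<forall>(F :: real ^ 'n \<Rightarrow> real) I T x x'.
        L_smooth L F \<longrightarrow> top_index_rule I \<longrightarrow> T \<in> {1..CARD('n)} \<longrightarrow> \<nabla> F x \<noteq> 0 \<longrightarrow>
        x' = x - \<gamma> *\<^sub>R sparsify I T (\<nabla> F x) \<longrightarrow>
        F x' \<le> F x - sparsification_ratio I F x T / (2 * L) * (norm (\<nabla> F x))\<^sup>2"
  proof (intro allI impI)
    fix F :: "real ^ 'n \<Rightarrow> real" and I T x x'
    assume smooth: "L_smooth L F" and nz: "\<nabla> F x \<noteq> 0"
      and x': "x' = x - \<gamma> *\<^sub>R sparsify I T (\<nabla> F x)"
    define v where "v = - (1 / L) *\<^sub>R sparsify I T (\<nabla> F x)"
    have "F x' = F (x + v)"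
      using x' assms(2) by (simp add: v_def)
    also have "\<dots> \<le> F x + (\<nabla> F x \<bullet> v + L / 2 * (norm v)\<^sup>2)"
      using L_smooth_quadratic_upper_bound[OF smooth, of x v] by simp
    also have "\<dots> = F x - sparsification_ratio I F x T / (2 * L) * (norm (\<nabla> F x))\<^sup>2"
      unfolding v_def quadratic_model_sparsified_step[OF assms(1)]
        sparsification_ratio_times_square_norm[of F, OF nz] by simp
    finally show "F x' \<le> F x - sparsification_ratio I F x T / (2 * L) * (norm (\<nabla> F x))\<^sup>2" .
  qed
next
  define F where "F = (\<lambda>x::real ^ 'n. L / 2 * (norm x)\<^sup>2)"
  have grad: "\<nabla> F x = L *\<^sub>R x" for x
    unfolding F_def by (rule gradient_half_square_norm(1))
  have smooth: "L_smooth L F"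
    unfolding F_def using assms(1) by (intro L_smooth_half_square_norm) simp
  have nonzero: "\<exists>x. \<nabla> F x \<noteq> 0"
    using assms(1) by (intro exI[of _ "axis undefined 1"]) (simp add: grad axis_eq_0_iff)
  have exact: "F (x + v) = F x + (\<nabla> F x \<bullet> v + L / 2 * (norm v)\<^sup>2)" for x v
    unfolding grad by (simp add: F_def power2_norm_eq_inner inner_add_left inner_add_right
        inner_commute[of v x] algebra_simps)
  have tight: "F x' = F x - sparsification_ratio I F x T / (2 * L) * (norm (\<nabla> F x))\<^sup>2"
    if nz: "\<nabla> F x \<noteq> 0" and x': "x' = x - \<gamma> *\<^sub>R sparsify I T (\<nabla> F x)" for I T x x'
  proof -
    define v where "v = - (1 / L) *\<^sub>R sparsify I T (\<nabla> F x)"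
    have "F x' = F (x + v)"
      using x' assms(2) by (simp add: v_def)
    also have "\<dots> = F x + (\<nabla> F x \<bullet> v + L / 2 * (norm v)\<^sup>2)"
      by (rule exact)
    also have "\<dots> = F x - sparsification_ratio I F x T / (2 * L) * (norm (\<nabla> F x))\<^sup>2"
      unfolding v_def quadratic_model_sparsified_step[OF assms(1)]
        sparsification_ratio_times_square_norm[of F, OF nz] by simp
    finally show ?thesis .
  qed
  show "\<exists>F :: real ^ 'n \<Rightarrow> real.
        L_smooth L F \<and> (\<exists>x. \<nabla> F x \<noteq> 0) \<and>
        (\<forall>I T x x'.
          top_index_rule I \<longrightarrow> T \<in> {1..CARD('n)} \<longrightarrow> \<nabla> F x \<noteq> 0 \<longrightarrow>
          x' = x - \<gamma> *\<^sub>R sparsify I T (\<nabla> F x) \<longrightarrow>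
          F x' = F x - sparsification_ratio I F x T / (2 * L) * (norm (\<nabla> F x))\<^sup>2)"
    using smooth nonzero tight by (intro exI[of _ F]) blast
qed

end
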